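(* Let $A$ be a unital C*-algebra and let $u,v$ be any pair of unitaries in $A$, where the spectrum of $u$ is the unit circle. Let $\alpha$ and $\beta$ be positive numbers satisfying $\beta^2=4(\alpha^2+1)$. Then for $\alpha>0.2568$ the element $$X=\sum_{m,n\in\mathbb{Z}} e(\beta^2mn/2)\,e^{-\pi\alpha\beta^2n^2/2}\,e^{-\pi\beta^2m^2/(2\alpha)}\,\Theta(m,n)\,u^mv^n$$ is invertible in $A$, where $$\Theta(m,n)=\vartheta_2\!\left(\tfrac{\pi}{2}\beta^2n,\,2i\alpha\right)\vartheta_3\!\left(i\tfrac{\pi}{2\alpha}\beta^2m,\,it_\alpha\right)+\vartheta_3\!\left(\tfrac{\pi}{2}\beta^2n,\,2i\alpha\right)\vartheta_2\!\left(i\tfrac{\pi}{2\alpha}\beta^2m,\,it_\alpha\right)$$ and $t_\alpha=4\alpha+\tfrac{2}{\alpha}$.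
   Context: Notation: $e(t):=e^{2\pi it}$ (while $e^{x}$ is the usual exponential). For $z,t\in\mathbb{C}$ with $\mathrm{Im}(t)>0$ the Theta functions are $$\vartheta_2(z,t)=\sum_{n\in\mathbb{Z}}e^{\pi it(n+\frac12)^2}e^{2iz(n+\frac12)},\qquad \vartheta_3(z,t)=\sum_{n\in\mathbb{Z}}e^{\pi itn^2}e^{2izn}.$$ No commutation relation between $u$ and $v$ is assumed. *)

theory Defs
  imports "HOL-Analysis.Analysis"
begin

text \<open>
  A unital complex C*-algebra. The complex scalar multiplication \<open>scaleC\<close> extends the real one
  provided by the parent class; unitality of the scalar action, \<open>scaleC 1 x = x\<close>, follows from
  \<open>scaleC_of_real\<close>. The parent class also requires \<open>norm 1 = 1\<close>, which holds in every C*-algebra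
  other than the zero algebra; in the zero algebra all spectra are empty.
\<close>

class unital_cstar_algebra = real_normed_algebra_1 + banach +
  fixes scaleC :: "complex \<Rightarrow> 'a \<Rightarrow> 'a"
    and star :: "'a \<Rightarrow> 'a"
  assumes scaleC_add_right: "scaleC c (x + y) = scaleC c x + scaleC c y"
    and scaleC_add_left: "scaleC (c + d) x = scaleC c x + scaleC d x"
    and scaleC_scaleC: "scaleC c (scaleC d x) = scaleC (c * d) x"
    and scaleC_of_real: "scaleC (complex_of_real r) x = scaleR r x"
    and norm_scaleC: "norm (scaleC c x) = cmod c * norm x"
    and scaleC_mult_left: "scaleC c x * y = scaleC c (x * y)"
    and scaleC_mult_right: "x * scaleC c y = scaleC c (x * y)"
    and star_add: "star (x + y) = star x + star y"
    and star_scaleC: "star (scaleC c x) = scaleC (cnj c) (star x)"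
    and star_mult: "star (x * y) = star y * star x"
    and star_star: "star (star x) = x"
    and cstar_identity: "norm (star x * x) = (norm x)\<^sup>2"

definition is_invertible :: "'a::monoid_mult \<Rightarrow> bool" where
  "is_invertible x \<longleftrightarrow> (\<exists>y. x * y = 1 \<and> y * x = 1)"

definition spectrum :: "'a::unital_cstar_algebra \<Rightarrow> complex set" where
  "spectrum x = {c. \<not> is_invertible (scaleC c 1 - x)}"

definition unitary :: "'a::unital_cstar_algebra \<Rightarrow> bool" where
  "unitary u \<longleftrightarrow> star u * u = 1 \<and> u * star u = 1"

text \<open>
  Integer powers of a unitary, whose inverse is its adjoint. (The library's \<open>powi\<close> needs an
  inverse operation on the type.)
\<close>

definition upow :: "'a::unital_cstar_algebra \<Rightarrow> int \<Rightarrow> 'a" where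
  "upow u m = (if m \<ge> 0 then u ^ nat m else star u ^ nat (- m))"

definition e2pii :: "complex \<Rightarrow> complex" where
  "e2pii t = exp (2 * pi * \<i> * t)"

text \<open>
  All series are unordered sums \<open>infsum\<close>, with value 0 when not summable. The theta series
  converge absolutely whenever \<open>Im t > 0\<close>.
\<close>

definition theta2 :: "complex \<Rightarrow> complex \<Rightarrow> complex" where
  "theta2 z t = (\<Sum>\<^sub>\<infinity>n::int. exp (pi * \<i> * t * (of_int n + 1/2)\<^sup>2) * exp (2 * \<i> * z * (of_int n + 1/2)))"

definition theta3 :: "complex \<Rightarrow> complex \<Rightarrow> complex" where
  "theta3 z t = (\<Sum>\<^sub>\<infinity>n::int. exp (pi * \<i> * t * (of_int n)\<^sup>2) * exp (2 * \<i> * z * of_int n))"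

definition t_param :: "real \<Rightarrow> real" where
  "t_param \<alpha> = 4 * \<alpha> + 2 / \<alpha>"

definition Theta :: "real \<Rightarrow> real \<Rightarrow> int \<Rightarrow> int \<Rightarrow> complex" where
  "Theta \<alpha> \<beta> m n =
     theta2 (pi / 2 * \<beta>\<^sup>2 * n) (2 * \<i> * \<alpha>) * theta3 (\<i> * (pi / (2 * \<alpha>)) * \<beta>\<^sup>2 * m) (\<i> * t_param \<alpha>)
   + theta3 (pi / 2 * \<beta>\<^sup>2 * n) (2 * \<i> * \<alpha>) * theta2 (\<i> * (pi / (2 * \<alpha>)) * \<beta>\<^sup>2 * m) (\<i> * t_param \<alpha>)"

definition X_coeff :: "real \<Rightarrow> real \<Rightarrow> int \<Rightarrow> int \<Rightarrow> complex" where
  "X_coeff \<alpha> \<beta> m n =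
     e2pii (\<beta>\<^sup>2 * m * n / 2) * exp (- pi * \<alpha> * \<beta>\<^sup>2 * n\<^sup>2 / 2) * exp (- pi * \<beta>\<^sup>2 * m\<^sup>2 / (2 * \<alpha>)) * Theta \<alpha> \<beta> m n"

text \<open>
  The double series, as an unordered norm-convergent sum over pairs. Where it fails to be
  summable, the value 0 is not invertible, so invertibility of \<open>X_elem\<close> includes convergence.
\<close>

definition X_elem :: "real \<Rightarrow> real \<Rightarrow> 'a::unital_cstar_algebra \<Rightarrow> 'a \<Rightarrow> 'a" where
  "X_elem \<alpha> \<beta> u v = (\<Sum>\<^sub>\<infinity>(m, n)\<in>UNIV. scaleC (X_coeff \<alpha> \<beta> m n) (upow u m * upow v n))"

end

theory Submission
  imports Defs
begin

text \<open>
  In the double series for \<open>X\<close>, the scalar term, with index \<open>(0, 0)\<close>, outweighs all the others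
  together: \<open>\<Sum>\<bar>X_coeff \<alpha> \<beta> m n\<bar> < 2 \<bar>X_coeff \<alpha> \<beta> 0 0\<bar>\<close>. Since the monomials \<open>u\<^sup>m v\<^sup>n\<close> have norm at
  most \<open>1\<close>, the Neumann series then inverts \<open>X\<close> (\<open>is_invertible_dominant_sum\<close>).

  The coefficients can be summed in closed form because of the relation \<open>\<beta>\<^sup>2 = 4 (\<alpha>\<^sup>2 + 1)\<close>. Write
  \<open>G r d = \<Sum>n. exp (- r (n + d)\<^sup>2)\<close>, over integers \<open>n\<close>, and \<open>p = 2 \<pi> (\<alpha> + 1/\<alpha>) = \<pi> \<beta>\<^sup>2 / (2 \<alpha>)\<close>.
  Completing the square in the theta series that depends on \<open>m\<close> absorbs the factor \<open>exp (- p m\<^sup>2)\<close> and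
  leaves \<open>\<Sum>l. exp (- p (m + l + d)\<^sup>2) exp (- 2 \<pi> \<alpha> (l + d)\<^sup>2)\<close>, where \<open>d = 0\<close> for \<open>theta3\<close> and
  \<open>d = 1/2\<close> for \<open>theta2\<close> (\<open>theta_char_complete_square\<close>). Summed over \<open>m\<close> this factors as
  \<open>G p d * G (2 \<pi> \<alpha>) d\<close>. The theta values that depend on \<open>n\<close> are taken at real arguments and bounded by
  their values at \<open>0\<close>, which are \<open>G (2 \<pi> \<alpha>) (1/2)\<close> and \<open>G (2 \<pi> \<alpha>) 0\<close>. Hence
  \<open>\<Sum>\<bar>X_coeff \<alpha> \<beta> m n\<bar>\<close> is at most
  \<open>G (2 \<pi> \<alpha>) (1/2) * G (2 \<pi> \<alpha>) 0 * (G p 0 + G p (1/2)) * G (2 \<pi> \<alpha> (\<alpha>\<^sup>2 + 1)) 0\<close>, and the sum in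
  parentheses, running over all half-integers, is \<open>G (p/4) 0\<close> (\<open>gauss_sum_halves\<close>).

  The coefficient at \<open>(0, 0)\<close> is at least \<open>G (2 \<pi> \<alpha>) (1/2)\<close>, so this factor cancels, and what remains
  is an inequality between numbers: the product of the three Gaussian sums
  \<open>G (2 \<pi> \<alpha>) 0\<close>, \<open>G (p/4) 0\<close> and \<open>G (2 \<pi> \<alpha> (\<alpha>\<^sup>2 + 1)) 0\<close> is less than \<open>2\<close>
  (\<open>gauss_sum_product_lt\<close>). At \<open>\<alpha> = 0.2568\<close> it is about \<open>1.91\<close>.
\<close>

section \<open>Diagonally dominant series in a Banach algebra\<close>

lemma is_invertible_one_minus:
  fixes x :: "'a::{real_normed_algebra_1,banach}"
  assumes "norm x < 1"
  shows "is_invertible (1 - x)"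
proof -
  have s: "summable (\<lambda>n. x ^ n)"
    by (rule complete_algebra_summable_geometric[OF assms])
  define y where "y = (\<Sum>n. x ^ n)"
  have shift: "(\<Sum>n. x ^ Suc n) = y - 1"
    using suminf_split_head[OF s] by (simp add: y_def)
  have "x * y = y - 1"
    using suminf_mult[OF s, of x] shift by (simp add: y_def)
  moreover have "y * x = y - 1"
    using suminf_mult2[OF s, of x] shift by (simp add: y_def power_commutes)
  ultimately have "(1 - x) * y = 1" "y * (1 - x) = 1"
    by (simp_all add: algebra_simps)
  then show ?thesis
    unfolding is_invertible_def by blast
qed

lemma scaleC_one_left: "scaleC 1 x = (x :: 'a::unital_cstar_algebra)"
  using scaleC_of_real[of 1 x] by simp

lemma is_invertible_scaleC:
  fixes x :: "'a::unital_cstar_algebra"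
  assumes "is_invertible x" and "c \<noteq> 0"
  shows "is_invertible (scaleC c x)"
proof -
  obtain y where "x * y = 1" "y * x = 1"
    using assms(1) unfolding is_invertible_def by blast
  then have "scaleC c x * scaleC (inverse c) y = 1" "scaleC (inverse c) y * scaleC c x = 1"
    using assms(2) by (simp_all add: scaleC_mult_left scaleC_mult_right scaleC_scaleC scaleC_one_left)
  then show ?thesis
    unfolding is_invertible_def by blast
qed

text \<open>
  The part of the sum away from \<open>k\<close> has norm at most \<open>B - g k \<le> B - cmod (c k) < cmod (c k)\<close>, so
  the sum is \<open>c k\<close> times an element at distance less than \<open>1\<close> from the unit. A summable majorant \<open>g\<close>
  is part of the statement because without summability \<open>infsum\<close> would return \<open>0\<close>.
\<close>

lemma is_invertible_dominant_sum:
  fixes c :: "'i \<Rightarrow> complex" and w :: "'i \<Rightarrow> 'a::unital_cstar_algebra"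
  assumes w: "\<And>i. norm (w i) \<le> 1" and w0: "w k = 1"
    and g: "(g has_sum B) UNIV" and c: "\<And>i. cmod (c i) \<le> g i"
    and B: "B < 2 * cmod (c k)"
  shows "is_invertible (\<Sum>\<^sub>\<infinity>i. scaleC (c i) (w i))"
proof -
  define f where "f i = scaleC (c i) (w i)" for i
  define R where "R = infsum f (UNIV - {k})"
  have le: "norm (f i) \<le> cmod (c i)" for i
    using mult_left_mono[OF w, of "cmod (c i)" i] by (simp add: f_def norm_scaleC)
  have le_g: "norm (f i) \<le> g i" for i
    using le c by (rule order_trans)
  have abs: "(\<lambda>i. norm (f i)) summable_on UNIV"
    using has_sum_imp_summable[OF g] by (rule Infinite_Sum.abs_summable_on_comparison_test') (rule le_g)
  have abs': "(\<lambda>i. norm (f i)) summable_on (UNIV - {k})"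
    using abs by (rule summable_on_subset) simp
  have g': "(g has_sum (B - g k)) (UNIV - {k})"
  proof -
    have "g summable_on (UNIV - {k})"
      using has_sum_imp_summable[OF g] by (rule summable_on_subset) simp
    then have "(g has_sum infsum g (UNIV - {k})) (UNIV - {k})"
      by (rule has_sum_infsum)
    moreover from this have "(g has_sum (g k + infsum g (UNIV - {k}))) (insert k (UNIV - {k}))"
      by (intro has_sum_insert) auto
    then have "g k + infsum g (UNIV - {k}) = B"
      using g has_sum_unique by (simp add: insert_UNIV) blast
    moreover from this have "infsum g (UNIV - {k}) = B - g k"
      by linarith
    ultimately show ?thesis
      by simp
  qed
  have sf: "f summable_on (UNIV - {k})"
    by (rule abs_summable_summable[OF abs'])
  have "norm R \<le> B - g k"
    unfolding R_def using has_sum_infsum[OF sf] g' by (rule norm_infsum_le) (rule le_g)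
  then have R: "norm R < cmod (c k)"
    using B c[of k] by linarith
  then have c0: "c k \<noteq> 0"
    by auto
  have "norm (scaleC (- inverse (c k)) R) = norm R / cmod (c k)"
    by (simp add: norm_scaleC norm_inverse divide_inverse mult.commute)
  then have "norm (scaleC (- inverse (c k)) R) < 1"
    using R c0 by simp
  then have "is_invertible (scaleC (c k) (1 - scaleC (- inverse (c k)) R))"
    by (intro is_invertible_scaleC is_invertible_one_minus c0)
  moreover have "scaleC (c k) (1 - scaleC (- inverse (c k)) R) = f k + R"
  proof -
    have "scaleC (c k) (scaleC (- inverse (c k)) R) = - R"
      using c0 scaleC_of_real[of "- 1" R] by (simp add: scaleC_scaleC)
    moreover have "scaleC (c k) (1 - y) = f k - scaleC (c k) y" for y
      using scaleC_add_right[of "c k" "1 - y" y] by (simp add: f_def w0 algebra_simps)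
    ultimately show ?thesis
      by simp
  qed
  moreover have "infsum f UNIV = f k + R"
    using infsum_insert[OF sf, of k] by (simp add: R_def insert_UNIV)
  ultimately have "is_invertible (infsum f UNIV)"
    by simp
  then show ?thesis
    unfolding f_def .
qed

lemma norm_upow_unitary_le:
  fixes u :: "'a::unital_cstar_algebra"
  assumes "unitary u"
  shows "norm (upow u m) \<le> 1"
proof -
  have "(norm u)\<^sup>2 = 1" "(norm (star u))\<^sup>2 = 1"
    using cstar_identity[of u] cstar_identity[of "star u"] assms
    by (simp_all add: unitary_def star_star)
  then have "norm u = 1" "norm (star u) = 1"
    by (simp_all add: power2_eq_1_iff)
      (smt (verit) norm_ge_zero)+
  then show ?thesis
    using norm_power_ineq[of u "nat m"] norm_power_ineq[of "star u" "nat (- m)"]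
    by (simp add: upow_def)
qed

section \<open>Gaussian sums over shifted integers\<close>

definition gauss_sum :: "real \<Rightarrow> real \<Rightarrow> real" where
  "gauss_sum r d = (\<Sum>\<^sub>\<infinity>n::int. exp (- (r * (of_int n + d)\<^sup>2)))"

lemma has_sum_even_int:
  fixes f :: "int \<Rightarrow> real"
  assumes S: "((\<lambda>k. f (int k)) has_sum S) {1..}" and even: "\<And>n. f (- n) = f n"
  shows "(f has_sum (f 0 + 2 * S)) UNIV"
proof -
  have pos: "(f has_sum S) {1..}"
  proof -
    have "(f has_sum S) {1..} \<longleftrightarrow> ((\<lambda>k. f (int k)) has_sum S) {1..}"
      by (rule has_sum_reindex_bij_witness[of _ int nat]) auto
    with S show ?thesis
      by simp
  qed
  moreover have neg: "(f has_sum S) {..-1}"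
  proof -
    have "(f has_sum S) {..-1} \<longleftrightarrow> (f has_sum S) {1..}"
      by (rule has_sum_reindex_bij_witness[of _ uminus uminus]) (auto simp: even)
    with pos show ?thesis
      by simp
  qed
  ultimately have "(f has_sum (S + S)) ({1..} \<union> {..-1})"
    by (rule has_sum_Un_disjoint) auto
  then have "(f has_sum (f 0 + (S + S))) (insert 0 ({1..} \<union> {..-1}))"
    by (rule has_sum_insert[rotated]) auto
  moreover have "insert 0 ({1..} \<union> {..-1}) = (UNIV :: int set)"
    by auto
  ultimately show ?thesis
    by simp
qed

lemma summable_on_gauss:
  fixes r d :: real
  assumes "r > 0"
  shows "(\<lambda>n::int. exp (- (r * (of_int n + d)\<^sup>2))) summable_on UNIV"
proof -
  have "((\<lambda>k. exp (- r) ^ k) has_sum (exp (- r) / (1 - exp (- r)))) {1..}"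
    using assms by (intro has_sum_geometric_from_1) auto
  then have "(\<lambda>n::int. exp (- r) ^ nat \<bar>n\<bar>) summable_on UNIV"
    using has_sum_even_int[of "\<lambda>n. exp (- r) ^ nat \<bar>n\<bar>"] by (auto simp: summable_on_def)
  then have "(\<lambda>n::int. exp (r * (\<bar>d\<bar> + 1/4)) * exp (- r) ^ nat \<bar>n\<bar>) summable_on UNIV"
    by (rule summable_on_cmult_right)
  \<comment> \<open>The exponent grows at least linearly, since \<open>x\<^sup>2 \<ge> \<bar>x\<bar> - 1/4\<close>.\<close>
  then show ?thesis
  proof (rule summable_on_comparison_test)
    fix n :: int
    have "0 \<le> (\<bar>of_int n + d\<bar> - 1/2)\<^sup>2"
      by simp
    also have "\<dots> = (of_int n + d)\<^sup>2 - \<bar>of_int n + d\<bar> + 1/4"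
      by (simp add: power2_diff power_divide)
    finally have "\<bar>of_int n\<bar> - \<bar>d\<bar> - 1/4 \<le> (of_int n + d)\<^sup>2"
      by linarith
    then have "r * (\<bar>of_int n\<bar> - \<bar>d\<bar> - 1/4) \<le> r * (of_int n + d)\<^sup>2"
      using assms by (intro mult_left_mono) auto
    then have "exp (- (r * (of_int n + d)\<^sup>2)) \<le> exp (r * (\<bar>d\<bar> + 1/4) + real (nat \<bar>n\<bar>) * (- r))"
      by (simp add: algebra_simps)
    then show "exp (- (r * (of_int n + d)\<^sup>2)) \<le> exp (r * (\<bar>d\<bar> + 1/4)) * exp (- r) ^ nat \<bar>n\<bar>"
      by (simp only: exp_add exp_of_nat_mult)
  qed simp
qed

lemma has_sum_gauss:
  fixes r d :: real
  assumes "r > 0"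
  shows "((\<lambda>n::int. exp (- (r * (of_int n + d)\<^sup>2))) has_sum gauss_sum r d) UNIV"
  unfolding gauss_sum_def using summable_on_gauss[OF assms] by (rule has_sum_infsum)

lemma has_sum_gauss_shift:
  fixes r d :: real
  assumes "r > 0"
  shows "((\<lambda>n::int. exp (- (r * (of_int n + of_int k + d)\<^sup>2))) has_sum gauss_sum r d) UNIV"
proof -
  have "((\<lambda>n::int. exp (- (r * (of_int n + of_int k + d)\<^sup>2))) has_sum gauss_sum r d) UNIV
      \<longleftrightarrow> ((\<lambda>n::int. exp (- (r * (of_int n + d)\<^sup>2))) has_sum gauss_sum r d) UNIV"
    by (rule has_sum_reindex_bij_witness[of _ "\<lambda>n. n - k" "\<lambda>n. n + k"]) auto
  then show ?thesis
    using has_sum_gauss[OF assms] by simp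
qed

lemma gauss_sum_pos:
  fixes r d :: real
  assumes "r > 0"
  shows "gauss_sum r d > 0"
proof -
  have "exp (- (r * (of_int 0 + d)\<^sup>2)) = sum (\<lambda>n. exp (- (r * (of_int n + d)\<^sup>2))) {0::int}"
    by simp
  also have "\<dots> \<le> gauss_sum r d"
    by (rule finite_sum_le_has_sum[OF has_sum_gauss[OF assms]]) auto
  finally show ?thesis
    using exp_gt_zero less_le_trans by blast
qed

text \<open>
  Integers and half-integers are the halves of the even and of the odd integers.
\<close>

lemma gauss_sum_halves:
  assumes "r > 0"
  shows "gauss_sum r 0 + gauss_sum r (1/2) = gauss_sum (r / 4) 0"
proof -
  let ?f = "\<lambda>n::int. exp (- (r / 4 * (of_int n + 0)\<^sup>2))"
  have "(?f has_sum gauss_sum r 0) {n. even n}"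
  proof -
    have "(?f has_sum gauss_sum r 0) {n. even n}
        \<longleftrightarrow> ((\<lambda>n::int. exp (- (r * (of_int n + 0)\<^sup>2))) has_sum gauss_sum r 0) UNIV"
      by (rule has_sum_reindex_bij_witness[of _ "\<lambda>n. 2 * n" "\<lambda>n. n div 2"])
        (auto simp: power2_eq_square elim!: evenE)
    with has_sum_gauss[OF assms] show ?thesis
      by blast
  qed
  moreover have "(?f has_sum gauss_sum r (1/2)) {n. odd n}"
  proof -
    have "(?f has_sum gauss_sum r (1/2)) {n. odd n}
        \<longleftrightarrow> ((\<lambda>n::int. exp (- (r * (of_int n + 1/2)\<^sup>2))) has_sum gauss_sum r (1/2)) UNIV"
      by (rule has_sum_reindex_bij_witness[of _ "\<lambda>n. 2 * n + 1" "\<lambda>n. n div 2"])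
        (auto simp: power2_eq_square field_simps elim!: oddE)
    with has_sum_gauss[OF assms] show ?thesis
      by blast
  qed
  ultimately have "(?f has_sum (gauss_sum r 0 + gauss_sum r (1/2))) ({n. even n} \<union> {n. odd n})"
    by (rule has_sum_Un_disjoint) auto
  moreover have "{n. even n} \<union> {n. odd n} = (UNIV :: int set)"
    by auto
  ultimately show ?thesis
    unfolding gauss_sum_def[of "r / 4"] by (metis infsumI)
qed

text \<open>
  The sum is \<open>1 + 2 (y + y\<^sup>4 + y\<^sup>9 + \<dots>)\<close> with \<open>y = exp (- r) \<le> x\<close>, and from its second term on the
  bracket is dominated by the geometric series \<open>x\<^sup>4 + x\<^sup>5 + \<dots>\<close>, because \<open>k\<^sup>2 \<ge> k + 2\<close> for \<open>k \<ge> 2\<close>.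
\<close>

lemma gauss_sum_le:
  assumes "exp (- r) \<le> x" and "x < 1"
  shows "gauss_sum r 0 \<le> 1 + 2 * (x + x ^ 4 / (1 - x))"
proof -
  let ?f = "\<lambda>n::int. exp (- (r * (of_int n + 0)\<^sup>2))"
  have "exp (- r) < 1"
    using assms by linarith
  then have r: "r > 0"
    by simp
  have x: "x > 0"
    using assms(1) exp_gt_zero less_le_trans by blast
  have "?f summable_on (int ` {1..})"
    using summable_on_gauss[OF r] by (rule summable_on_subset) simp
  then have s: "(\<lambda>k. ?f (int k)) summable_on {1..}"
    by (subst (asm) summable_on_reindex) (auto simp: o_def)
  define S where "S = infsum (\<lambda>k. ?f (int k)) {1..}"
  have S: "((\<lambda>k. ?f (int k)) has_sum S) {1..}"
    unfolding S_def using s by (rule has_sum_infsum)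
  have "((\<lambda>k. x ^ k) has_sum (x / (1 - x))) {1..}"
    using x assms(2) by (intro has_sum_geometric_from_1) auto
  then have "((\<lambda>k. x ^ 3 * x ^ k) has_sum (x ^ 3 * (x / (1 - x)))) {1..}"
    by (rule has_sum_cmult_right)
  moreover have "x ^ 3 * (x / (1 - x)) = x ^ 4 / (1 - x)"
    by (simp add: eval_nat_numeral)
  ultimately have "((\<lambda>k. x ^ 3 * x ^ k) has_sum (x ^ 4 / (1 - x))) {1..}"
    by (simp only:)
  moreover have "((\<lambda>k. if k = 1 then x else x ^ (k + 2)) has_sum (x ^ 4 / (1 - x))) {2..}
      \<longleftrightarrow> ((\<lambda>k. x ^ 3 * x ^ k) has_sum (x ^ 4 / (1 - x))) {1..}"
    by (rule has_sum_reindex_bij_witness[of _ "\<lambda>k. k + 1" "\<lambda>k. k - 1"])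
      (auto simp flip: power_add)
  ultimately have "((\<lambda>k. if k = 1 then x else x ^ (k + 2)) has_sum (x ^ 4 / (1 - x))) {2..}"
    by blast
  then have "((\<lambda>k. if k = 1 then x else x ^ (k + 2)) has_sum (x + x ^ 4 / (1 - x))) (insert 1 {2..})"
    using has_sum_insert[of 1 "{2..}" "\<lambda>k. if k = 1 then x else x ^ (k + 2)"] by auto
  moreover have "insert 1 {2..} = {1::nat..}"
    by auto
  ultimately have M: "((\<lambda>k::nat. if k = 1 then x else x ^ (k + 2)) has_sum (x + x ^ 4 / (1 - x))) {1..}"
    by simp
  have "S \<le> x + x ^ 4 / (1 - x)"
  proof (rule has_sum_mono[OF S M])
    fix k :: nat
    assume k: "k \<in> {1..}"
    show "?f (int k) \<le> (if k = 1 then x else x ^ (k + 2))"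
    proof (cases "k = 1")
      case True
      then show ?thesis
        using assms by simp
    next
      case False
      with k have "k \<ge> 2"
        by auto
      then have "k * k \<ge> 2 * k"
        by (intro mult_right_mono) auto
      with \<open>k \<ge> 2\<close> have "k + 2 \<le> k * k"
        by linarith
      have "?f (int k) = exp (- r) ^ (k * k)"
        by (subst exp_of_nat_mult[symmetric]) (simp add: power2_eq_square algebra_simps)
      also have "\<dots> \<le> exp (- r) ^ (k + 2)"
        using \<open>k + 2 \<le> k * k\<close> r by (intro power_decreasing) auto
      also have "\<dots> \<le> x ^ (k + 2)"
        using assms by (intro power_mono) auto
      finally show ?thesis
        using False by simp
    qed
  qed
  moreover have "gauss_sum r 0 = 1 + 2 * S"
    unfolding gauss_sum_def using has_sum_even_int[OF S] by (intro infsumI) simp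
  ultimately show ?thesis
    by simp
qed

text \<open>
  For fixed \<open>l\<close> the inner sum over \<open>m\<close> does not see the shift by \<open>l\<close>, so the double sum splits when
  \<open>m\<close> is summed first; all terms are positive, which permits exchanging the order.
\<close>

lemma has_sum_gauss_convolution:
  fixes d :: real
  assumes p: "p > 0" and r: "r > 0"
  defines "h \<equiv> \<lambda>m l. exp (- (p * (of_int m + of_int l + d)\<^sup>2)) * exp (- (r * (of_int l + d)\<^sup>2))"
  shows "h m summable_on UNIV"
    and "((\<lambda>m::int. \<Sum>\<^sub>\<infinity>l::int. h m l) has_sum (gauss_sum p d * gauss_sum r d)) UNIV"
proof -
  have inner: "((\<lambda>m::int. case_prod (\<lambda>l m. h m l) (l, m)) has_sum
      (gauss_sum p d * exp (- (r * (of_int l + d)\<^sup>2)))) UNIV" for l :: int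
    using has_sum_cmult_left[OF has_sum_gauss_shift[OF p]] by (simp add: h_def)
  have outer: "((\<lambda>l::int. gauss_sum p d * exp (- (r * (of_int l + d)\<^sup>2))) has_sum
      (gauss_sum p d * gauss_sum r d)) UNIV"
    by (rule has_sum_cmult_right[OF has_sum_gauss[OF r]])
  have "case_prod (\<lambda>l m. h m l) summable_on (UNIV \<times> UNIV)"
    using inner has_sum_imp_summable[OF outer]
    by (rule summable_on_SigmaI) (simp add: h_def)
  then have "(case_prod (\<lambda>l m. h m l) has_sum (gauss_sum p d * gauss_sum r d)) (UNIV \<times> UNIV)"
    by (rule has_sum_SigmaI[OF inner outer])
  then have double: "(case_prod h has_sum (gauss_sum p d * gauss_sum r d)) (UNIV \<times> UNIV)"
    by (subst has_sum_swap) simp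
  show row: "h m summable_on UNIV" for m
    using has_sum_imp_summable[OF double] by (rule summable_on_SigmaD1) simp
  show "((\<lambda>m::int. \<Sum>\<^sub>\<infinity>l::int. h m l) has_sum (gauss_sum p d * gauss_sum r d)) UNIV"
    using double by (rule has_sum_SigmaD) (simp add: row)
qed

section \<open>Theta values as Gaussian sums\<close>

text \<open>
  The theta function with characteristic \<open>d\<close>, which covers \<open>theta3\<close> (\<open>d = 0\<close>) and \<open>theta2\<close>
  (\<open>d = 1/2\<close>) at once.
\<close>

definition theta_char :: "real \<Rightarrow> complex \<Rightarrow> complex \<Rightarrow> complex" where
  "theta_char d z t = (\<Sum>\<^sub>\<infinity>n::int. exp (pi * \<i> * t * (of_int n + d)\<^sup>2) * exp (2 * \<i> * z * (of_int n + d)))"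

lemma theta2_eq: "theta2 z t = theta_char (1/2) z t"
  by (simp add: theta2_def theta_char_def)

lemma theta3_eq: "theta3 z t = theta_char 0 z t"
  by (simp add: theta3_def theta_char_def)

lemma cmod_theta_char_le:
  assumes "s > 0"
  shows "cmod (theta_char d (complex_of_real x) (\<i> * complex_of_real s)) \<le> gauss_sum (pi * s) d"
proof -
  let ?f = "\<lambda>n::int. exp (pi * \<i> * (\<i> * complex_of_real s) * (complex_of_int n + d)\<^sup>2)
    * exp (2 * \<i> * complex_of_real x * (complex_of_int n + d))"
  have norm: "cmod (?f n) = exp (- (pi * s * (of_int n + d)\<^sup>2))" for n
  proof -
    have "?f n = exp (complex_of_real (- (pi * s * (of_int n + d)\<^sup>2)))
        * exp (\<i> * complex_of_real (2 * x * (of_int n + d)))"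
      by (simp add: algebra_simps)
    then show ?thesis
      by (simp only: norm_mult norm_exp_i_times norm_exp_eq_Re Re_complex_of_real Re_i_times
        Im_complex_of_real minus_zero exp_zero mult_1_right)
  qed
  have "0 < pi * s"
    using assms by simp
  then have "(\<lambda>n. cmod (?f n)) summable_on UNIV"
    unfolding norm by (rule summable_on_gauss)
  then have "cmod (theta_char d (complex_of_real x) (\<i> * complex_of_real s)) \<le> (\<Sum>\<^sub>\<infinity>n. cmod (?f n))"
    unfolding theta_char_def by (rule norm_infsum_bound)
  then show ?thesis
    by (simp only: norm gauss_sum_def)
qed

lemma theta_char_zero:
  assumes "s > 0"
  shows "theta_char d 0 (\<i> * complex_of_real s) = complex_of_real (gauss_sum (pi * s) d)"
proof -
  have "0 < pi * s"
    using assms by simp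
  then have "((\<lambda>n::int. complex_of_real (exp (- (pi * s * (of_int n + d)\<^sup>2)))) has_sum
      complex_of_real (gauss_sum (pi * s) d)) UNIV"
    by (intro has_sum_of_real has_sum_gauss)
  then show ?thesis
    unfolding theta_char_def by (intro infsumI) (simp add: exp_of_real algebra_simps flip: exp_of_real)
qed

text \<open>
  The dependence of the coefficients on \<open>m\<close>, after completing the square.
\<close>

definition gauss_row :: "real \<Rightarrow> real \<Rightarrow> int \<Rightarrow> real" where
  "gauss_row a d m = (\<Sum>\<^sub>\<infinity>l::int. exp (- (2 * pi * (a + 1 / a) * (of_int m + of_int l + d)\<^sup>2))
     * exp (- (2 * pi * a * (of_int l + d)\<^sup>2)))"

lemma gauss_row_nonneg: "gauss_row a d m \<ge> 0"
  unfolding gauss_row_def by (rule infsum_nonneg) simp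

lemma
  assumes "a > 0"
  shows summable_on_gauss_row: "(\<lambda>l::int. exp (- (2 * pi * (a + 1 / a) * (of_int m + of_int l + d)\<^sup>2))
      * exp (- (2 * pi * a * (of_int l + d)\<^sup>2))) summable_on UNIV"
    and has_sum_gauss_row: "(gauss_row a d has_sum
      (gauss_sum (2 * pi * (a + 1 / a)) d * gauss_sum (2 * pi * a) d)) UNIV"
proof -
  have pos: "2 * pi * (a + 1 / a) > 0" "2 * pi * a > 0"
    using assms by (auto intro!: mult_pos_pos add_pos_pos)
  show "(\<lambda>l::int. exp (- (2 * pi * (a + 1 / a) * (of_int m + of_int l + d)\<^sup>2))
      * exp (- (2 * pi * a * (of_int l + d)\<^sup>2))) summable_on UNIV"
    using has_sum_gauss_convolution(1)[OF pos] .
  show "(gauss_row a d has_sum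
      (gauss_sum (2 * pi * (a + 1 / a)) d * gauss_sum (2 * pi * a) d)) UNIV"
    using has_sum_gauss_convolution(2)[OF pos, of d] unfolding gauss_row_def .
qed

text \<open>
  Put \<open>L = l + d\<close> and \<open>p = \<pi> b\<^sup>2 / (2 a) = 2 \<pi> (a + 1/a)\<close>. The exponents add up to
  \<open>- p m\<^sup>2 - 2 p m L - \<pi> t_param a L\<^sup>2 = - p (m + L)\<^sup>2 - (\<pi> t_param a - p) L\<^sup>2\<close>, and
  \<open>\<pi> t_param a - p = 2 \<pi> a\<close>.
\<close>

lemma theta_char_complete_square:
  assumes a: "a > 0" and b: "b\<^sup>2 = 4 * (a\<^sup>2 + 1)"
  shows "exp (- pi * b\<^sup>2 * m\<^sup>2 / (2 * a)) * theta_char d (\<i> * (pi / (2 * a)) * b\<^sup>2 * m) (\<i> * t_param a)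
    = complex_of_real (gauss_row a d m)"
proof -
  define f where "f l = exp (- (2 * pi * (a + 1 / a) * (of_int m + of_int l + d)\<^sup>2))
      * exp (- (2 * pi * a * (of_int l + d)\<^sup>2))" for l :: int
  define g where "g l = exp (pi * \<i> * (\<i> * t_param a) * (complex_of_int l + d)\<^sup>2)
      * exp (2 * \<i> * (\<i> * (pi / (2 * a)) * b\<^sup>2 * m) * (complex_of_int l + d))" for l :: int
  define E where "E = exp (- pi * b\<^sup>2 * m\<^sup>2 / (2 * a))"
  have E: "E > 0"
    by (simp add: E_def)
  have term_eq: "g l = complex_of_real (inverse E * f l)" for l
  proof -
    have expo: "- pi * t_param a * (of_int l + d)\<^sup>2 + (- pi / a * b\<^sup>2 * m * (of_int l + d))
        = pi * b\<^sup>2 * m\<^sup>2 / (2 * a) + (- (2 * pi * (a + 1 / a) * (of_int m + of_int l + d)\<^sup>2)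
          + - (2 * pi * a * (of_int l + d)\<^sup>2))"
      using a unfolding b t_param_def by (simp add: field_simps power2_eq_square)
    have "g l = complex_of_real (exp (- pi * t_param a * (of_int l + d)\<^sup>2)
        * exp (- pi / a * b\<^sup>2 * m * (of_int l + d)))"
      unfolding g_def by (simp add: algebra_simps flip: exp_of_real)
    also have "\<dots> = complex_of_real (exp (pi * b\<^sup>2 * m\<^sup>2 / (2 * a)) * f l)"
      unfolding f_def by (simp only: exp_add[symmetric] expo)
    also have "exp (pi * b\<^sup>2 * m\<^sup>2 / (2 * a)) = inverse E"
      by (simp add: E_def flip: exp_minus)
    finally show ?thesis .
  qed
  have "(f has_sum gauss_row a d m) UNIV"
    unfolding gauss_row_def f_def using summable_on_gauss_row[OF a] by (rule has_sum_infsum)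
  then have "((\<lambda>l. inverse E * f l) has_sum (inverse E * gauss_row a d m)) UNIV"
    by (rule has_sum_cmult_right)
  then have "(g has_sum complex_of_real (inverse E * gauss_row a d m)) UNIV"
    unfolding term_eq by (rule has_sum_of_real)
  then have "theta_char d (\<i> * (pi / (2 * a)) * b\<^sup>2 * m) (\<i> * t_param a)
      = complex_of_real (inverse E * gauss_row a d m)"
    unfolding theta_char_def g_def by (rule infsumI)
  moreover have "exp (- pi * b\<^sup>2 * m\<^sup>2 / (2 * a)) = complex_of_real E"
    by (simp only: E_def)
  ultimately show ?thesis
    using E by (simp only: of_real_mult of_real_inverse) simp
qed

lemma X_coeff_eq:
  assumes a: "a > 0" and b: "b\<^sup>2 = 4 * (a\<^sup>2 + 1)"
  shows "X_coeff a b m n = e2pii (b\<^sup>2 * m * n / 2) * complex_of_real (exp (- (2 * pi * a * (a\<^sup>2 + 1) * (of_int n)\<^sup>2)))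
    * (theta_char (1/2) (complex_of_real (pi / 2 * b\<^sup>2 * n)) (\<i> * complex_of_real (2 * a)) * gauss_row a 0 m
      + theta_char 0 (complex_of_real (pi / 2 * b\<^sup>2 * n)) (\<i> * complex_of_real (2 * a)) * gauss_row a (1/2) m)"
proof -
  have n: "- pi * a * b\<^sup>2 * n\<^sup>2 / 2 = - (2 * pi * a * (a\<^sup>2 + 1) * (of_int n)\<^sup>2)"
    unfolding b by simp
  have i: "2 * \<i> * complex_of_real a = \<i> * complex_of_real (2 * a)"
    by simp
  show ?thesis
    unfolding X_coeff_def Theta_def theta2_eq theta3_eq theta_char_complete_square[OF a b, symmetric] n i
    by (simp add: algebra_simps)
qed

section \<open>The numerical estimate\<close>

text \<open>
  Truncated Taylor series turn upper bounds for \<open>exp (- x)\<close> into rational arithmetic.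
\<close>

lemma exp_neg_le:
  fixes x :: real
  assumes "0 \<le> y" "y \<le> x" "1 \<le> q * (\<Sum>k<N. y ^ k / fact k)" "0 < q"
  shows "exp (- x) \<le> q"
proof -
  have "(\<Sum>k<N. y ^ k / fact k) \<le> exp y"
  proof -
    have s: "(\<lambda>k. y ^ k / fact k) sums exp y"
      using exp_converges[of y] by (simp add: divide_inverse mult.commute)
    then show ?thesis
      using sum_le_suminf[OF sums_summable[OF s], of "{..<N}"] assms(1)
      by (simp add: sums_unique[OF s, symmetric])
  qed
  also have "\<dots> \<le> exp x"
    using assms by simp
  finally have "q * (\<Sum>k<N. y ^ k / fact k) \<le> q * exp x"
    using assms by simp
  then have "1 \<le> q * exp x"
    using assms by linarith
  then show ?thesis
    by (simp add: exp_minus field_simps)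
qed

text \<open>
  The sums with parameters \<open>2 \<pi> \<alpha>\<close> and \<open>2 \<pi> \<alpha> (\<alpha>\<^sup>2 + 1)\<close> decrease in \<open>\<alpha>\<close>, so each may be replaced by a
  bound at the left end of an interval. The third parameter behaves differently: \<open>\<alpha> + 1 / \<alpha>\<close> is large
  for small \<open>\<alpha>\<close> but only \<open>2\<close> at \<open>\<alpha> = 1\<close>. One choice of bounds for all \<open>\<alpha>\<close> would be too weak, so the
  range is cut at \<open>0.3\<close>: below, the third sum is almost \<open>1\<close>; above, the other two are already small
  enough to allow for \<open>\<alpha> + 1 / \<alpha> \<ge> 2\<close>. The bounds used multiply to about \<open>1.975\<close> and \<open>1.90\<close>.
\<close>

lemma gauss_sum_product_lt:
  assumes "\<alpha> > 0.2568"
  shows "gauss_sum (2 * pi * \<alpha> * (\<alpha>\<^sup>2 + 1)) 0 * (gauss_sum (2 * pi * \<alpha>) 0 * gauss_sum (pi / 2 * (\<alpha> + 1 / \<alpha>)) 0) < 2"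
proof -
  have pi: "pi \<ge> 3.14"
    using pi_approx by simp
  have prod: "gauss_sum r1 0 * (gauss_sum r2 0 * gauss_sum r3 0) < 2"
    if q: "exp (- r1) \<le> q1" "exp (- r2) \<le> q2" "exp (- r3) \<le> q3" "q1 < 1" "q2 < 1" "q3 < 1"
      and lt: "(1 + 2 * (q1 + q1 ^ 4 / (1 - q1))) * ((1 + 2 * (q2 + q2 ^ 4 / (1 - q2))) * (1 + 2 * (q3 + q3 ^ 4 / (1 - q3)))) < 2"
    for r1 r2 r3 q1 q2 q3 :: real
  proof -
    have "0 < r1" "0 < r2" "0 < r3"
      using q by (smt (verit) exp_le_cancel_iff exp_zero)+
    then have "0 < gauss_sum r1 0" "0 < gauss_sum r2 0" "0 < gauss_sum r3 0"
      by (auto intro: gauss_sum_pos)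
    moreover note gauss_sum_le[OF q(1,4)] gauss_sum_le[OF q(2,5)] gauss_sum_le[OF q(3,6)]
    ultimately have "gauss_sum r1 0 * (gauss_sum r2 0 * gauss_sum r3 0)
      \<le> (1 + 2 * (q1 + q1 ^ 4 / (1 - q1))) * ((1 + 2 * (q2 + q2 ^ 4 / (1 - q2))) * (1 + 2 * (q3 + q3 ^ 4 / (1 - q3))))"
      by (intro mult_mono mult_nonneg_nonneg) auto
    then show ?thesis
      using lt by linarith
  qed
  have mono: "2 * 3.14 * s \<le> 2 * pi * \<alpha>" "2 * 3.14 * s * (s\<^sup>2 + 1) \<le> 2 * pi * \<alpha> * (\<alpha>\<^sup>2 + 1)"
    if "0 \<le> s" "s \<le> \<alpha>" for s
  proof -
    have "3.14 * s \<le> pi * \<alpha>"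
      using that pi by (intro mult_mono) auto
    then show le: "2 * 3.14 * s \<le> 2 * pi * \<alpha>"
      by simp
    have "s\<^sup>2 + 1 \<le> \<alpha>\<^sup>2 + 1"
      using that by (intro add_mono power_mono) auto
    with le show "2 * 3.14 * s * (s\<^sup>2 + 1) \<le> 2 * pi * \<alpha> * (\<alpha>\<^sup>2 + 1)"
      by (rule mult_mono) (use that pi in auto)
  qed
  show ?thesis
  proof (cases "\<alpha> \<le> 0.3")
    case True
    have "10 / 3 \<le> 1 / \<alpha>"
      using True assms by (simp add: field_simps)
    then have "3.5 \<le> \<alpha> + 1 / \<alpha>"
      using assms by simp
    then have "3 / 2 * 3.5 \<le> pi / 2 * (\<alpha> + 1 / \<alpha>)"
      using pi by (intro mult_mono) auto
    moreover have "5.25 \<le> 3 / 2 * (3.5 :: real)"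
      by simp
    ultimately have "5.25 \<le> pi / 2 * (\<alpha> + 1 / \<alpha>)"
      by (rule order_trans[rotated])
    then have w: "exp (- (pi / 2 * (\<alpha> + 1 / \<alpha>))) \<le> 0.007"
      by (intro exp_neg_le[where y = "5.25" and N = 10]) (auto simp: eval_nat_numeral fact_numeral)
    have q: "exp (- (2 * pi * \<alpha>)) \<le> 0.21"
      using mono(1)[of "0.2568"] assms by (intro exp_neg_le[where y = "1.6" and N = 6]) (auto simp: eval_nat_numeral)
    have y: "exp (- (2 * pi * \<alpha> * (\<alpha>\<^sup>2 + 1))) \<le> 0.182"
      using mono(2)[of "0.2568"] assms by (intro exp_neg_le[where y = "1.719" and N = 8]) (auto simp: eval_nat_numeral)
    show ?thesis
      by (rule prod[OF y q w]) (simp_all add: eval_nat_numeral)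
  next
    case False
    have "2 \<le> \<alpha> + 1 / \<alpha>"
      using sum_squares_ge_zero[of "\<alpha> - 1" 0] assms by (simp add: field_simps power2_eq_square)
    then have "3 / 2 * 2 \<le> pi / 2 * (\<alpha> + 1 / \<alpha>)"
      using pi by (intro mult_mono) auto
    moreover have "3 \<le> 3 / 2 * (2 :: real)"
      by simp
    ultimately have "3 \<le> pi / 2 * (\<alpha> + 1 / \<alpha>)"
      by (rule order_trans[rotated])
    then have w: "exp (- (pi / 2 * (\<alpha> + 1 / \<alpha>))) \<le> 0.06"
      by (intro exp_neg_le[where y = "3" and N = 7]) (auto simp: eval_nat_numeral)
    have q: "exp (- (2 * pi * \<alpha>)) \<le> 0.16"
      using mono(1)[of "0.3"] False by (intro exp_neg_le[where y = "1.88" and N = 7]) (auto simp: eval_nat_numeral)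
    have y: "exp (- (2 * pi * \<alpha> * (\<alpha>\<^sup>2 + 1))) \<le> 0.14"
      using mono(2)[of "0.3"] False by (intro exp_neg_le[where y = "2.05" and N = 7]) (auto simp: eval_nat_numeral)
    show ?thesis
      by (rule prod[OF y q w]) (simp_all add: eval_nat_numeral)
  qed
qed

section \<open>Invertibility\<close>

theorem theorem1p3:
  fixes u v :: "'a::unital_cstar_algebra" and \<alpha> \<beta> :: real
  assumes "unitary u" and "unitary v"
    and "spectrum u = sphere 0 1"
    and "\<alpha> > 0" and "\<beta> > 0"
    and "\<beta>\<^sup>2 = 4 * (\<alpha>\<^sup>2 + 1)"
    and "\<alpha> > 0.2568"
  shows "is_invertible (X_elem \<alpha> \<beta> u v)"
proof -
  note a = \<open>\<alpha> > 0\<close> and b = \<open>\<beta>\<^sup>2 = 4 * (\<alpha>\<^sup>2 + 1)\<close>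
  define p where "p = 2 * pi * (\<alpha> + 1 / \<alpha>)"
  define r where "r = 2 * pi * \<alpha>"
  define s where "s = 2 * pi * \<alpha> * (\<alpha>\<^sup>2 + 1)"
  \<comment> \<open>The values at \<open>0\<close> of the theta functions that depend on \<open>n\<close>.\<close>
  define T where "T d = gauss_sum r d" for d
  define row where "row m = T (1/2) * gauss_row \<alpha> 0 m + T 0 * gauss_row \<alpha> (1/2) m" for m
  define col where "col n = exp (- (s * (of_int n + 0)\<^sup>2))" for n :: int
  define c where "c i = X_coeff \<alpha> \<beta> (fst i) (snd i)" for i
  define B where "B = T (1/2) * (gauss_sum s 0 * (T 0 * gauss_sum (p / 4) 0))"
  have pos: "p > 0" "r > 0" "s > 0"
    using a by (auto simp: p_def r_def s_def intro!: mult_pos_pos add_pos_pos add_nonneg_pos)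
  have T: "T d > 0" for d
    unfolding T_def by (rule gauss_sum_pos[OF pos(2)])
  have r': "pi * (2 * \<alpha>) = r"
    by (simp add: r_def)
  have theta_le: "cmod (theta_char d (complex_of_real x) (\<i> * complex_of_real (2 * \<alpha>))) \<le> T d" for d x
    using cmod_theta_char_le[of "2 * \<alpha>" d x] a by (simp add: T_def r')
  have coeff: "cmod (c (m, n)) \<le> row m * col n" for m n
  proof -
    let ?z = "complex_of_real (pi / 2 * \<beta>\<^sup>2 * n)"
    have "cmod (theta_char (1/2) ?z (\<i> * complex_of_real (2 * \<alpha>)) * gauss_row \<alpha> 0 m
        + theta_char 0 ?z (\<i> * complex_of_real (2 * \<alpha>)) * gauss_row \<alpha> (1/2) m) \<le> row m"
      unfolding row_def
      by (rule order_trans[OF norm_triangle_ineq], unfold norm_mult norm_of_real abs_of_nonneg[OF gauss_row_nonneg])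
        (intro add_mono mult_right_mono theta_le gauss_row_nonneg)
    moreover have "cmod (e2pii (\<beta>\<^sup>2 * m * n / 2)) = 1"
      by (simp add: e2pii_def norm_exp_eq_Re)
    moreover have "col n = exp (- (2 * pi * \<alpha> * (\<alpha>\<^sup>2 + 1) * (of_int n)\<^sup>2))"
      by (simp add: col_def s_def)
    ultimately show ?thesis
      unfolding c_def fst_conv snd_conv X_coeff_eq[OF a b] norm_mult
      by (simp add: mult.commute mult_right_mono)
  qed
  have row: "(row has_sum (T (1/2) * (T 0 * gauss_sum (p / 4) 0))) UNIV"
  proof -
    have "(row has_sum (T (1/2) * (gauss_sum p 0 * T 0) + T 0 * (gauss_sum p (1/2) * T (1/2)))) UNIV"
      unfolding row_def T_def p_def r_def
      by (intro has_sum_add has_sum_cmult_right has_sum_gauss_row a)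
    moreover have "T (1/2) * (gauss_sum p 0 * T 0) + T 0 * (gauss_sum p (1/2) * T (1/2))
        = T (1/2) * (T 0 * gauss_sum (p / 4) 0)"
      by (simp add: algebra_simps flip: gauss_sum_halves[OF pos(1)])
    ultimately show ?thesis
      by simp
  qed
  have row_nonneg: "row m \<ge> 0" for m
    unfolding row_def using T gauss_row_nonneg by (intro add_nonneg_nonneg mult_nonneg_nonneg) (auto intro: less_imp_le)
  have total: "((\<lambda>i. row (fst i) * col (snd i)) has_sum B) UNIV"
  proof -
    have inner: "((\<lambda>n. row (fst (m, n)) * col (snd (m, n))) has_sum (row m * gauss_sum s 0)) UNIV" for m
      unfolding fst_conv snd_conv col_def by (rule has_sum_cmult_right[OF has_sum_gauss[OF pos(3)]])
    have outer: "((\<lambda>m. row m * gauss_sum s 0) has_sum B) UNIV"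
      using has_sum_cmult_left[OF row, of "gauss_sum s 0"] by (simp add: B_def mult_ac)
    have "((\<lambda>i. row (fst i) * col (snd i)) has_sum B) (UNIV \<times> UNIV)"
      using inner outer
      by (rule has_sum_SigmaI)
        (rule summable_on_SigmaI[OF inner has_sum_imp_summable[OF outer]], simp add: row_nonneg col_def)
    then show ?thesis
      by simp
  qed
  \<comment> \<open>At \<open>(0, 0)\<close> all terms are positive; only the \<open>l = 0\<close> term of \<open>gauss_row \<alpha> 0 0\<close> is kept.\<close>
  have c00: "T (1/2) \<le> cmod (c (0, 0))"
  proof -
    have "1 = (\<Sum>l\<in>{0}. exp (- (2 * pi * (\<alpha> + 1 / \<alpha>) * (of_int 0 + of_int l + 0)\<^sup>2))
        * exp (- (2 * pi * \<alpha> * (of_int l + 0)\<^sup>2)))"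
      by simp
    also have "\<dots> \<le> gauss_row \<alpha> 0 0"
      unfolding gauss_row_def by (rule finite_sum_le_infsum[OF summable_on_gauss_row[OF a]]) auto
    finally have "T (1/2) * 1 \<le> T (1/2) * gauss_row \<alpha> 0 0"
      using T by (intro mult_left_mono) (auto intro: less_imp_le)
    also have "\<dots> \<le> row 0"
      unfolding row_def using T gauss_row_nonneg by (auto intro!: mult_nonneg_nonneg intro: less_imp_le)
    finally have "T (1/2) \<le> row 0"
      by simp
    moreover have "c (0, 0) = complex_of_real (row 0)"
      using a theta_char_zero[of "2 * \<alpha>"] unfolding r'
      by (simp add: c_def X_coeff_eq[OF a b] e2pii_def row_def T_def)
    ultimately show ?thesis
      by simp
  qed
  have "gauss_sum s 0 * (T 0 * gauss_sum (p / 4) 0) < 2"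
  proof -
    have "p / 4 = pi / 2 * (\<alpha> + 1 / \<alpha>)"
      by (simp add: p_def)
    then show ?thesis
      using gauss_sum_product_lt[OF \<open>\<alpha> > 0.2568\<close>] by (simp only: s_def T_def r_def)
  qed
  then have "B < T (1/2) * 2"
    unfolding B_def using T by (intro mult_strict_left_mono)
  with c00 have B: "B < 2 * cmod (c (0, 0))"
    by linarith
  have norm_le: "norm (upow u (fst i) * upow v (snd i)) \<le> 1" for i
    using norm_mult_ineq[of "upow u (fst i)" "upow v (snd i)"]
      mult_le_one[OF norm_upow_unitary_le[OF assms(1)] norm_ge_zero norm_upow_unitary_le[OF assms(2)]]
    by (rule order_trans)
  have "is_invertible (\<Sum>\<^sub>\<infinity>i. scaleC (c i) (upow u (fst i) * upow v (snd i)))"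
  proof (rule is_invertible_dominant_sum[where k = "(0, 0)"])
    show "norm (upow u (fst i) * upow v (snd i)) \<le> 1" for i
      by (rule norm_le)
    show "((\<lambda>i. row (fst i) * col (snd i)) has_sum B) UNIV" "B < 2 * cmod (c (0, 0))"
      by (rule total, rule B)
    show "upow u (fst (0, 0)) * upow v (snd (0, 0)) = 1"
      by (simp add: upow_def)
    show "cmod (c i) \<le> row (fst i) * col (snd i)" for i
      using coeff[of "fst i" "snd i"] by simp
  qed
  then show ?thesis
    by (simp add: X_elem_def c_def case_prod_unfold)
qed

end
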